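(* Let $X,Y\in L^1$ be non-degenerate real random variables whose distributions have no atoms and whose supports are intervals. If $X\leq_c Y$ (i.e. $F_Y^{-1}\circ F_X$ is convex), then $s_{2,X}(\alpha)\leq s_{2,Y}(\alpha)$ for each $\alpha\in(0,1/2)$.
   Context: $L^1$ denotes the set of random variables with finite mean. $F_X$ denotes the cumulative distribution function (cdf) of $X$; under the assumptions (interval support, no atoms) $F_X$ has a strictly increasing and continuous inverse $F_X^{-1}$ on $(0,1)$, and similarly for $Y$. Convex transformation order (van Zwet): $X\leq_c Y$ (also written $F_X\leq_c F_Y$) means that $F_Y^{-1}\circ F_X$ is convex (on the interior of the support of $X$, where $F_X$ takes values in $(0,1)$). Expectiles: for $\alpha\in(0,1)$ and $X\in L^1$, the $\alpha$-expectile $e_X(\alpha)$ is the unique minimizer over $t\in\mathbb{R}$ of $E[\ell_\alpha(X-t)-\ell_\alpha(X)]$, where $\ell_\alpha(x)=\alpha x^2$ for $x\ge 0$ and $\ell_\alpha(x)=(1-\alpha)x^2$ for $x<0$. Equivalently, $e_X(\alpha)$ is the unique $t\in\mathbb{R}$ solving $\alpha E(X-t)_+=(1-\alpha)E(X-t)_-$, where $x_+=\max\{x,0\}$ and $x_-=\max\{-x,0\}$. Expectile skewness: with $\mu=EX$, for $\alpha\in(0,1/2)$, $$s_{2,X}(\alpha)=\frac{1}{1-2\alpha}\cdot\frac{e_X(1-\alpha)+e_X(\alpha)-2\mu}{e_X(1-\alpha)-e_X(\alpha)},$$ and $s_{2,Y}$ is defined analogously with $EY$ in place of $\mu$. *)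

theory Defs
  imports "HOL-Probability.Probability"
begin

definition rv_cdf :: "'a measure \<Rightarrow> ('a \<Rightarrow> real) \<Rightarrow> real \<Rightarrow> real" where
  "rv_cdf M X = cdf (distr M borel X)"

definition rv_support :: "'a measure \<Rightarrow> ('a \<Rightarrow> real) \<Rightarrow> real set" where
  "rv_support M X = {x. \<forall>U. open U \<and> x \<in> U \<longrightarrow> measure (distr M borel X) U > 0}"

definition no_atoms :: "'a measure \<Rightarrow> ('a \<Rightarrow> real) \<Rightarrow> bool" where
  "no_atoms M X \<longleftrightarrow> (\<forall>x. measure (distr M borel X) {x} = 0)"

definition non_degenerate :: "'a measure \<Rightarrow> ('a \<Rightarrow> real) \<Rightarrow> bool" where
  "non_degenerate M X \<longleftrightarrow> \<not> (\<exists>c. AE w in M. X w = c)"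

text \<open>If the distribution has no atoms and its support is an interval, then the cdf maps the
  interior of the support bijectively and increasingly onto the open unit interval. The function
  below is the inverse of that bijection; it is meaningful only on the open unit interval.\<close>

definition rv_cdf_inv :: "'a measure \<Rightarrow> ('a \<Rightarrow> real) \<Rightarrow> real \<Rightarrow> real" where
  "rv_cdf_inv M X = the_inv_into (interior (rv_support M X)) (rv_cdf M X)"

text \<open>Van Zwet's convex transformation order. The two random variables may live on different
  probability spaces. Outside the interior of the support the cdf is 0 or 1, where the inverse is
  not defined, hence the restriction of the domain of convexity.\<close>

definition convex_transform_le ::
    "'a measure \<Rightarrow> ('a \<Rightarrow> real) \<Rightarrow> 'b measure \<Rightarrow> ('b \<Rightarrow> real) \<Rightarrow> bool" where
  "convex_transform_le M X N Y \<longleftrightarrow>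
     convex_on (interior (rv_support M X)) (rv_cdf_inv N Y \<circ> rv_cdf M X)"

definition expectile_loss :: "real \<Rightarrow> real \<Rightarrow> real" where
  "expectile_loss \<alpha> x = (if x \<ge> 0 then \<alpha> * x\<^sup>2 else (1 - \<alpha>) * x\<^sup>2)"

text \<open>Subtracting the loss at \<open>X\<close> makes the integrand integrable for every \<open>t\<close> as soon as \<open>X\<close> is
  integrable, without a second moment.\<close>

definition expectile :: "'a measure \<Rightarrow> ('a \<Rightarrow> real) \<Rightarrow> real \<Rightarrow> real" where
  "expectile M X \<alpha> = (THE t. is_arg_min
     (\<lambda>t. \<integral>w. expectile_loss \<alpha> (X w - t) - expectile_loss \<alpha> (X w) \<partial>M) (\<lambda>_. True) t)"

definition expectile_skewness :: "'a measure \<Rightarrow> ('a \<Rightarrow> real) \<Rightarrow> real \<Rightarrow> real" where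
  "expectile_skewness M X \<alpha> =
     1 / (1 - 2 * \<alpha>) *
     ((expectile M X (1 - \<alpha>) + expectile M X \<alpha> - 2 * (\<integral>w. X w \<partial>M)) /
      (expectile M X (1 - \<alpha>) - expectile M X \<alpha>))"

end

theory Submission
  imports Defs
begin

text \<open>
  Write \<open>\<phi> = F\<^sub>Y\<^sup>-\<^sup>1 \<circ> F\<^sub>X\<close>, an increasing convex function on the interior of the support of \<open>X\<close>.
  The variable \<open>\<phi>(X)\<close> has the distribution of \<open>Y\<close> (lemma \<open>quantile_coupling\<close>), so it suffices to
  compare \<open>X\<close> with \<open>\<phi>(X)\<close>, on one probability space. Expectiles and the mean are equivariant, hence
  the skewness is invariant, under increasing affine maps. Composing \<open>\<phi>\<close> with such a map, one may
  assume that \<open>X\<close> and \<open>Z = \<phi>(X)\<close> share both expectiles \<open>a = e(\<alpha>) < b = e(1 - \<alpha>)\<close>. The two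
  skewnesses then differ only through the means, and the claim becomes \<open>E Z \<le> E X\<close>
  (lemma \<open>mean_convex_transform_le\<close>).

  Suppose \<open>E Z > E X\<close>. The expectile equations determine the tail expectations beyond \<open>a\<close> and
  \<open>b\<close> from the mean:
  \<open>(1 - 2 \<alpha>) E(a - X)\<^sub>+ = \<alpha> (E X - a)\<close> and \<open>(1 - 2 \<alpha>) E(X - b)\<^sub>+ = \<alpha> (b - E X)\<close>, and likewise for \<open>Z\<close>.
  So \<open>E(a - Z)\<^sub>+ > E(a - X)\<^sub>+\<close> and \<open>E(Z - b)\<^sub>+ < E(X - b)\<^sub>+\<close>. Truncation to \<open>[a, b]\<close> subtracts the
  upper tail from a variable and adds the lower one, so the truncation of \<open>Z\<close> has a larger mean than
  that of \<open>X\<close>. Each of the three strict inequalities is witnessed at a point: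
  there are \<open>l\<close> with \<open>\<phi>(l) < min a l\<close>, \<open>r > b\<close> with \<open>\<phi>(r) < r\<close>, and \<open>m < b\<close> with
  \<open>\<phi>(m) > max a m\<close>. Monotonicity gives \<open>l < m\<close> since \<open>\<phi>(l) < a < \<phi>(m)\<close>, and \<open>m < b < r\<close>. Thus the
  convex function \<open>\<phi>(x) - x\<close> is negative at \<open>l\<close> and at \<open>r\<close> but positive in between, which is absurd.
\<close>

section \<open>Expectiles as roots of the first-order condition\<close>

text \<open>Up to a factor of \<open>- 2\<close>, this is the derivative in \<open>t\<close> of the objective that the expectile
  minimizes.\<close>

definition expectile_balance :: "'a measure \<Rightarrow> ('a \<Rightarrow> real) \<Rightarrow> real \<Rightarrow> real \<Rightarrow> real" where
  "expectile_balance M X \<alpha> t =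
     \<alpha> * (\<integral>w. max (X w - t) 0 \<partial>M) - (1 - \<alpha>) * (\<integral>w. max (t - X w) 0 \<partial>M)"

text \<open>The loss is strongly convex: it lies above its tangents by a quadratic term. Therefore a root
  of the first-order condition is the only minimizer of the expected loss, as integrating the bound
  shows. If the step from \<open>y\<close> to \<open>y - d\<close> crosses the origin, both the
  smaller coefficient and \<open>(y - d)\<^sup>2 \<le> d\<^sup>2\<close> are used.\<close>
lemma expectile_loss_ge_tangent:
  assumes "0 < \<alpha>" "\<alpha> < 1"
  shows "expectile_loss \<alpha> y - 2 * d * (\<alpha> * max y 0 - (1 - \<alpha>) * max (- y) 0)
           + min \<alpha> (1 - \<alpha>) * d\<^sup>2 \<le> expectile_loss \<alpha> (y - d)"
proof -
  let ?c = "min \<alpha> (1 - \<alpha>)"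
  have c: "?c \<le> \<alpha>" "?c \<le> 1 - \<alpha>" "?c = \<alpha> \<or> ?c = 1 - \<alpha>" by auto
  have same: "k * y\<^sup>2 - 2 * d * (k * y) + ?c * d\<^sup>2 \<le> k * (y - d)\<^sup>2" if "?c \<le> k" for k
    using mult_right_mono[OF that, of "d\<^sup>2"] by (simp add: power2_diff algebra_simps)
  have cross: "k * y\<^sup>2 - 2 * d * (k * y) + ?c * d\<^sup>2 \<le> m * (y - d)\<^sup>2"
    if "?c \<le> m" "?c \<le> k" "(y - d)\<^sup>2 \<le> d\<^sup>2" "?c = k \<or> ?c = m" for k m
  proof -
    have "k * y\<^sup>2 - 2 * d * (k * y) = k * (y - d)\<^sup>2 - k * d\<^sup>2"
      by (simp add: power2_diff algebra_simps)
    moreover have "(k - ?c) * (y - d)\<^sup>2 \<le> (k - ?c) * d\<^sup>2"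
      using that by (intro mult_left_mono) auto
    moreover have "?c * (y - d)\<^sup>2 \<le> m * (y - d)\<^sup>2"
      using that by (intro mult_right_mono) auto
    ultimately show ?thesis by (simp add: algebra_simps)
  qed
  consider "y \<ge> 0" "y - d \<ge> 0" | "y \<ge> 0" "y - d < 0" | "y < 0" "y - d < 0" | "y < 0" "y - d \<ge> 0"
    by linarith
  then show ?thesis
  proof cases
    case 1 then show ?thesis using same[of \<alpha>] c by (simp add: expectile_loss_def)
  next
    case 2
    then have "(y - d)\<^sup>2 \<le> d\<^sup>2" by (intro abs_le_square_iff[THEN iffD1]) auto
    with 2 show ?thesis using cross[OF c(2,1) _ c(3)] by (simp add: expectile_loss_def)
  next
    case 3 then show ?thesis using same[of "1 - \<alpha>"] c by (simp add: expectile_loss_def)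
  next
    case 4
    then have "(y - d)\<^sup>2 \<le> d\<^sup>2" by (intro abs_le_square_iff[THEN iffD1]) auto
    with 4 show ?thesis using cross[OF c(1,2) _ disj_commute[THEN iffD1, OF c(3)]]
      by (simp add: expectile_loss_def)
  qed
qed

text \<open>The increment of the loss grows only linearly in \<open>y\<close>, which makes it integrable under a mere
  first moment. It follows from the tangent bound applied at both end points.\<close>
lemma abs_expectile_loss_diff_le:
  assumes "0 < \<alpha>" "\<alpha> < 1"
  shows "\<bar>expectile_loss \<alpha> (y - d) - expectile_loss \<alpha> y\<bar> \<le> 2 * \<bar>d\<bar> * \<bar>y\<bar> + 2 * d\<^sup>2"
proof -
  have D: "\<bar>d * (\<alpha> * max x 0 - (1 - \<alpha>) * max (- x) 0)\<bar> \<le> \<bar>d\<bar> * \<bar>x\<bar>" for x d :: real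
  proof -
    have "\<bar>\<alpha> * max x 0 - (1 - \<alpha>) * max (- x) 0\<bar> \<le> \<bar>x\<bar>"
      using assms mult_right_mono[of \<alpha> 1 "\<bar>x\<bar>"] mult_right_mono[of "1 - \<alpha>" 1 "\<bar>x\<bar>"]
      by (auto simp: max_def abs_mult abs_if zero_less_mult_iff mult_less_0_iff)
    then show ?thesis by (simp add: abs_mult mult_left_mono)
  qed
  have c: "0 \<le> min \<alpha> (1 - \<alpha>) * x\<^sup>2" for x using assms by simp
  have low: "expectile_loss \<alpha> y - 2 * (\<bar>d\<bar> * \<bar>y\<bar>) \<le> expectile_loss \<alpha> (y - d)" for y d
    using expectile_loss_ge_tangent[OF assms, of y d] c[of d] D[of d y] by linarith
  note low[of y d]
  moreover have "expectile_loss \<alpha> (y - d) - 2 * (\<bar>d\<bar> * \<bar>y - d\<bar>) \<le> expectile_loss \<alpha> y"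
    using low[of "y - d" "- d"] by simp
  moreover have "\<bar>d\<bar> * \<bar>y - d\<bar> \<le> \<bar>d\<bar> * \<bar>y\<bar> + d\<^sup>2"
    using mult_left_mono[of "\<bar>y - d\<bar>" "\<bar>y\<bar> + \<bar>d\<bar>" "\<bar>d\<bar>"]
    by (simp add: power2_eq_square distrib_left)
  moreover have "0 \<le> d\<^sup>2" by simp
  ultimately show ?thesis unfolding mult.assoc by linarith
qed

text \<open>This turns strict inequalities between means into witnesses that may be chosen in a set of full
  measure.\<close>
lemma integral_less_imp_ex:
  fixes f g :: "'a \<Rightarrow> real"
  assumes "integrable M f" "integrable M g" "AE w in M. P w"
    and "integral\<^sup>L M f < integral\<^sup>L M g"
  obtains w where "P w" "f w < g w"
proof -
  have "\<not> (AE w in M. g w \<le> f w)"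
    using integral_mono_AE[OF assms(2,1)] assms(4) by fastforce
  then show thesis using that assms(3) by (metis (mono_tags, lifting) AE_mp AE_I2 not_le)
qed

context prob_space
begin

lemma integrable_max_diff:
  fixes X :: "'a \<Rightarrow> real"
  assumes "integrable M X"
  shows "integrable M (\<lambda>w. max (X w - t) 0)" "integrable M (\<lambda>w. max (t - X w) 0)"
  using assms by (auto intro!: integrable_max)

lemma pos_part_minus_neg_part:
  fixes X :: "'a \<Rightarrow> real"
  assumes "integrable M X"
  shows "(\<integral>w. max (X w - t) 0 \<partial>M) - (\<integral>w. max (t - X w) 0 \<partial>M) = (\<integral>w. X w \<partial>M) - t"
proof -
  have "(\<integral>w. max (X w - t) 0 \<partial>M) - (\<integral>w. max (t - X w) 0 \<partial>M)
      = (\<integral>w. max (X w - t) 0 - max (t - X w) 0 \<partial>M)"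
    using integrable_max_diff[OF assms] by (subst Bochner_Integration.integral_diff) auto
  also have "\<dots> = (\<integral>w. X w - t \<partial>M)"
    by (intro Bochner_Integration.integral_cong) auto
  also have "\<dots> = (\<integral>w. X w \<partial>M) - t" using assms by (simp add: prob_space)
  finally show ?thesis .
qed

lemma expectile_eqI:
  assumes X: "integrable M X" and \<alpha>: "0 < \<alpha>" "\<alpha> < 1" and t: "expectile_balance M X \<alpha> t = 0"
  shows "expectile M X \<alpha> = t"
proof -
  let ?L = "\<lambda>t. \<integral>w. expectile_loss \<alpha> (X w - t) - expectile_loss \<alpha> (X w) \<partial>M"
  let ?c = "min \<alpha> (1 - \<alpha>)"
  have [measurable]: "X \<in> borel_measurable M" using X by auto
  have [measurable]: "expectile_loss \<alpha> \<in> borel_measurable borel"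
    unfolding expectile_loss_def by measurable
  have int: "integrable M (\<lambda>w. expectile_loss \<alpha> (X w - t) - expectile_loss \<alpha> (X w))" for t
    by (rule Bochner_Integration.integrable_bound[where f = "\<lambda>w. 2 * \<bar>t\<bar> * \<bar>X w\<bar> + 2 * t\<^sup>2"])
      (use X abs_expectile_loss_diff_le[OF \<alpha>, of _ t] in \<open>auto intro!: AE_I2\<close>)
  have lin: "(\<integral>w. f w - g w + r \<partial>M) = (\<integral>w. f w \<partial>M) - (\<integral>w. g w \<partial>M) + r"
    if "integrable M f" "integrable M g" for f g :: "'a \<Rightarrow> real" and r :: real
    using that by (simp add: prob_space)
  have grow: "?L t + ?c * (s - t)\<^sup>2 \<le> ?L s" for s
  proof -
    let ?G = "\<lambda>w. 2 * (s - t) * (\<alpha> * max (X w - t) 0 - (1 - \<alpha>) * max (t - X w) 0)"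
    have iG: "integrable M ?G" using integrable_max_diff[OF X, of t] by auto
    have "(\<integral>w. ?G w \<partial>M) = 2 * (s - t) * expectile_balance M X \<alpha> t"
      unfolding expectile_balance_def using integrable_max_diff[OF X, of t] by simp
    then have G0: "(\<integral>w. ?G w \<partial>M) = 0" using t by simp
    have "(\<integral>w. (expectile_loss \<alpha> (X w - t) - expectile_loss \<alpha> (X w)) - ?G w + ?c * (s - t)\<^sup>2 \<partial>M) \<le> ?L s"
    proof (rule integral_mono)
      fix w
      show "(expectile_loss \<alpha> (X w - t) - expectile_loss \<alpha> (X w)) - ?G w + ?c * (s - t)\<^sup>2
          \<le> expectile_loss \<alpha> (X w - s) - expectile_loss \<alpha> (X w)"
        using expectile_loss_ge_tangent[OF \<alpha>, of "X w - t" "s - t"] by simp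
    qed (use int iG in auto)
    also have "(\<integral>w. (expectile_loss \<alpha> (X w - t) - expectile_loss \<alpha> (X w)) - ?G w + ?c * (s - t)\<^sup>2 \<partial>M)
        = ?L t - (\<integral>w. ?G w \<partial>M) + ?c * (s - t)\<^sup>2"
      by (rule lin[OF int iG])
    finally show ?thesis by (simp only: G0 diff_0_right)
  qed
  have c: "?c > 0" using \<alpha> by simp
  show ?thesis unfolding expectile_def
  proof (rule the_equality)
    have "?L t \<le> ?L s" for s
    proof -
      have "0 \<le> ?c * (s - t)\<^sup>2" using c by simp
      then show ?thesis using grow[of s] by linarith
    qed
    then show "is_arg_min ?L (\<lambda>_. True) t" unfolding is_arg_min_linorder by blast
  next
    fix s assume "is_arg_min ?L (\<lambda>_. True) s"
    then have "?L s \<le> ?L t" unfolding is_arg_min_linorder by blast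
    then have "?c * (s - t)\<^sup>2 \<le> 0" using grow[of s] by linarith
    then have "(s - t)\<^sup>2 \<le> 0" using c by (simp only: mult_le_0_iff) linarith
    then show "s = t" by simp
  qed
qed

text \<open>The balance is continuous because \<open>t \<mapsto> E(X - t)\<^sub>+\<close> is 1-Lipschitz; it is nonnegative far to the
  left and nonpositive far to the right, so the intermediate value theorem applies.\<close>
lemma expectile_balance_zero_ex:
  assumes X: "integrable M X" and \<alpha>: "0 < \<alpha>" "\<alpha> < 1"
  shows "\<exists>t. expectile_balance M X \<alpha> t = 0"
proof -
  note i = integrable_max_diff[OF X]
  have lip: "\<bar>(\<integral>w. max (X w - s) 0 \<partial>M) - (\<integral>w. max (X w - t) 0 \<partial>M)\<bar> \<le> \<bar>s - t\<bar>" for s t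
  proof -
    have "\<bar>\<integral>w. max (X w - s) 0 - max (X w - t) 0 \<partial>M\<bar>
        \<le> (\<integral>w. \<bar>max (X w - s) 0 - max (X w - t) 0\<bar> \<partial>M)" by (rule integral_abs_bound)
    also have "\<dots> \<le> (\<integral>w. \<bar>s - t\<bar> \<partial>M)" using i by (intro integral_mono) auto
    finally show ?thesis using i by (simp add: prob_space)
  qed
  have cp: "continuous_on UNIV (\<lambda>t. \<integral>w. max (X w - t) 0 \<partial>M)"
  proof (rule lipschitz_on_continuous_on[of 1])
    show "1-lipschitz_on UNIV (\<lambda>t. \<integral>w. max (X w - t) 0 \<partial>M)"
      using lip by (auto simp: lipschitz_on_def dist_real_def)
  qed
  have eq: "expectile_balance M X \<alpha>
      = (\<lambda>t. (2 * \<alpha> - 1) * (\<integral>w. max (X w - t) 0 \<partial>M) + (1 - \<alpha>) * ((\<integral>w. X w \<partial>M) - t))"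
    unfolding expectile_balance_def
    by (rule ext) (simp add: pos_part_minus_neg_part[OF X, symmetric] algebra_simps)
  have cont: "continuous_on UNIV (expectile_balance M X \<alpha>)"
    unfolding eq by (intro continuous_intros cp)
  let ?A = "\<integral>w. \<bar>X w\<bar> \<partial>M" and ?\<mu> = "\<integral>w. X w \<partial>M"
  have A: "0 \<le> ?A" "\<bar>?\<mu>\<bar> \<le> ?A" by auto
  have low: "?\<mu> - t \<le> (\<integral>w. max (X w - t) 0 \<partial>M)" "t - ?\<mu> \<le> (\<integral>w. max (t - X w) 0 \<partial>M)" for t
  proof -
    have "0 \<le> (\<integral>w. max (X w - t) 0 \<partial>M)" "0 \<le> (\<integral>w. max (t - X w) 0 \<partial>M)"
      by (auto intro!: Bochner_Integration.integral_nonneg)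
    then show "?\<mu> - t \<le> (\<integral>w. max (X w - t) 0 \<partial>M)" "t - ?\<mu> \<le> (\<integral>w. max (t - X w) 0 \<partial>M)"
      using pos_part_minus_neg_part[OF X, of t] by linarith+
  qed
  (* Far out, one term of the balance grows linearly in K and beats the other one, which stays
     bounded by E|X|; the factor 2 also absorbs the contribution of the mean. *)
  define K where "K = 2 * ?A / \<alpha>"
  define K' where "K' = 2 * ?A / (1 - \<alpha>)"
  have K: "0 \<le> K" "\<alpha> * K = 2 * ?A" and K': "0 \<le> K'" "(1 - \<alpha>) * K' = 2 * ?A"
    using \<alpha> A by (auto simp: K_def K'_def)
  have \<mu>: "\<bar>\<alpha> * ?\<mu>\<bar> \<le> ?A" "\<bar>(1 - \<alpha>) * ?\<mu>\<bar> \<le> ?A"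
    using \<alpha> A mult_mono[of \<alpha> 1 "\<bar>?\<mu>\<bar>" ?A] mult_mono[of "1 - \<alpha>" 1 "\<bar>?\<mu>\<bar>" ?A]
    by (auto simp: abs_mult)
  have "(\<integral>w. max (- K - X w) 0 \<partial>M) \<le> ?A"
    using i K X by (intro integral_mono) auto
  then have "(1 - \<alpha>) * (\<integral>w. max (- K - X w) 0 \<partial>M) \<le> 1 * ?A" using \<alpha> A by (intro mult_mono) auto
  moreover have "\<alpha> * (?\<mu> - (- K)) \<le> \<alpha> * (\<integral>w. max (X w - (- K)) 0 \<partial>M)"
    using low(1)[of "- K"] \<alpha> by (intro mult_left_mono) auto
  ultimately have pos: "0 \<le> expectile_balance M X \<alpha> (- K)"
    using K \<mu>(1) unfolding expectile_balance_def by (simp add: algebra_simps)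
  have "(\<integral>w. max (X w - K') 0 \<partial>M) \<le> ?A"
    using i K' X by (intro integral_mono) auto
  then have "\<alpha> * (\<integral>w. max (X w - K') 0 \<partial>M) \<le> 1 * ?A" using \<alpha> A by (intro mult_mono) auto
  moreover have "(1 - \<alpha>) * (K' - ?\<mu>) \<le> (1 - \<alpha>) * (\<integral>w. max (K' - X w) 0 \<partial>M)"
    using low(2)[of "K'"] \<alpha> by (intro mult_left_mono) auto
  ultimately have neg: "expectile_balance M X \<alpha> K' \<le> 0"
    using K' \<mu>(2) unfolding expectile_balance_def by (simp add: algebra_simps abs_le_iff)
  have "- K \<le> K'" using K(1) K'(1) by linarith
  moreover have "continuous_on {- K..K'} (expectile_balance M X \<alpha>)"
    by (rule continuous_on_subset[OF cont subset_UNIV])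
  ultimately obtain t where "expectile_balance M X \<alpha> t = 0"
    by (rule IVT2'[where f = "expectile_balance M X \<alpha>" and y = 0, OF neg pos, THEN exE]) blast
  then show ?thesis ..
qed

lemma expectile_balance_expectile:
  assumes "integrable M X" "0 < \<alpha>" "\<alpha> < 1"
  shows "expectile_balance M X \<alpha> (expectile M X \<alpha>) = 0"
proof -
  obtain t where t: "expectile_balance M X \<alpha> t = 0"
    using expectile_balance_zero_ex[OF assms] by (rule exE)
  then show ?thesis by (simp add: expectile_eqI[OF assms t])
qed

section \<open>Expectiles, the mean and affine maps\<close>

text \<open>The expectile equation and \<open>E(X - t)\<^sub>+ - E(X - t)\<^sub>- = E X - t\<close> are two linear equations for the two
  partial moments at the expectile, so these are functions of the mean and the expectile alone.\<close>
lemma expectile_tails: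
  assumes X: "integrable M X" and \<alpha>: "0 < \<alpha>" "\<alpha> < 1 / 2"
  shows "(1 - 2 * \<alpha>) * (\<integral>w. max (expectile M X \<alpha> - X w) 0 \<partial>M)
           = \<alpha> * ((\<integral>w. X w \<partial>M) - expectile M X \<alpha>)" (is ?lower)
    and "(1 - 2 * \<alpha>) * (\<integral>w. max (X w - expectile M X (1 - \<alpha>)) 0 \<partial>M)
           = \<alpha> * (expectile M X (1 - \<alpha>) - (\<integral>w. X w \<partial>M))" (is ?upper)
proof -
  have alg: "(1 - 2 * \<alpha>) * q = \<alpha> * d" if "\<alpha> * p - (1 - \<alpha>) * q = 0" "p - q = d" for p q d :: real
    using that(1) unfolding that(2)[symmetric] by (simp add: algebra_simps)
  have \<alpha>1: "\<alpha> < 1" "0 < 1 - \<alpha>" "1 - \<alpha> < 1" using \<alpha> by auto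
  show ?lower
    using expectile_balance_expectile[OF X \<alpha>(1) \<alpha>1(1)] pos_part_minus_neg_part[OF X]
    unfolding expectile_balance_def by (rule alg)
  let ?e = "expectile M X (1 - \<alpha>)"
  have "\<alpha> * (\<integral>w. max (?e - X w) 0 \<partial>M) - (1 - \<alpha>) * (\<integral>w. max (X w - ?e) 0 \<partial>M) = 0"
    using expectile_balance_expectile[OF X \<alpha>1(2,3)] by (simp add: expectile_balance_def)
  moreover have "(\<integral>w. max (?e - X w) 0 \<partial>M) - (\<integral>w. max (X w - ?e) 0 \<partial>M) = ?e - (\<integral>w. X w \<partial>M)"
    using pos_part_minus_neg_part[OF X, of ?e] by linarith
  ultimately show ?upper by (rule alg)
qed

text \<open>An expectile of level other than one half that equals the mean would make both partial moments
  vanish there, forcing \<open>X\<close> to be almost surely constant. On which side of the mean it lies follows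
  from the nonnegative left-hand sides of the tail identities.\<close>
lemma expectile_mean_less:
  assumes X: "integrable M X" and nd: "non_degenerate M X" and \<alpha>: "0 < \<alpha>" "\<alpha> < 1 / 2"
  shows "expectile M X \<alpha> < (\<integral>w. X w \<partial>M)" "(\<integral>w. X w \<partial>M) < expectile M X (1 - \<alpha>)"
proof -
  let ?\<mu> = "\<integral>w. X w \<partial>M"
  note i = integrable_max_diff[OF X]
  have nn: "0 \<le> (\<integral>w. max (X w - t) 0 \<partial>M)" "0 \<le> (\<integral>w. max (t - X w) 0 \<partial>M)" for t
    by (rule Bochner_Integration.integral_nonneg, simp)+
  have tails_at_mean: "(\<integral>w. max (X w - ?\<mu>) 0 \<partial>M) \<noteq> 0" "(\<integral>w. max (?\<mu> - X w) 0 \<partial>M) \<noteq> 0"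
  proof -
    have eq: "(\<integral>w. max (X w - ?\<mu>) 0 \<partial>M) = (\<integral>w. max (?\<mu> - X w) 0 \<partial>M)"
      using pos_part_minus_neg_part[OF X, of ?\<mu>] by linarith
    have False if z: "(\<integral>w. max (X w - ?\<mu>) 0 \<partial>M) = 0"
    proof -
      have "AE w in M. max (X w - ?\<mu>) 0 = 0"
        using z by (subst (asm) integral_nonneg_eq_0_iff_AE[OF i(1)]) simp_all
      moreover have "AE w in M. max (?\<mu> - X w) 0 = 0"
        using z unfolding eq by (subst (asm) integral_nonneg_eq_0_iff_AE[OF i(2)]) simp_all
      ultimately have "AE w in M. X w = ?\<mu>" by eventually_elim linarith
      then show False using nd unfolding non_degenerate_def by blast
    qed
    then show "(\<integral>w. max (X w - ?\<mu>) 0 \<partial>M) \<noteq> 0" "(\<integral>w. max (?\<mu> - X w) 0 \<partial>M) \<noteq> 0"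
      unfolding eq by blast+
  qed
  have pos: "0 < d" if "(1 - 2 * \<alpha>) * q = \<alpha> * d" "0 \<le> q" "d = 0 \<Longrightarrow> q \<noteq> 0" for q d :: real
  proof -
    have "0 \<le> \<alpha> * d" using that(2) \<alpha> unfolding that(1)[symmetric] by simp
    then have "0 \<le> d" using \<alpha> by (simp add: zero_le_mult_iff)
    moreover have "d \<noteq> 0" using that(1,3) \<alpha> by auto
    ultimately show ?thesis by simp
  qed
  have "0 < ?\<mu> - expectile M X \<alpha>"
  proof (rule pos[OF expectile_tails(1)[OF X \<alpha>] nn(2)])
    assume "?\<mu> - expectile M X \<alpha> = 0"
    then have "expectile M X \<alpha> = ?\<mu>" by simp
    then show "(\<integral>w. max (expectile M X \<alpha> - X w) 0 \<partial>M) \<noteq> 0" using tails_at_mean(2) by simp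
  qed
  then show "expectile M X \<alpha> < ?\<mu>" by simp
  have "0 < expectile M X (1 - \<alpha>) - ?\<mu>"
  proof (rule pos[OF expectile_tails(2)[OF X \<alpha>] nn(1)])
    assume "expectile M X (1 - \<alpha>) - ?\<mu> = 0"
    then have "expectile M X (1 - \<alpha>) = ?\<mu>" by simp
    then show "(\<integral>w. max (X w - expectile M X (1 - \<alpha>)) 0 \<partial>M) \<noteq> 0" using tails_at_mean(1) by simp
  qed
  then show "?\<mu> < expectile M X (1 - \<alpha>)" by simp
qed

lemma expectile_affine:
  assumes X: "integrable M X" and \<alpha>: "0 < \<alpha>" "\<alpha> < 1" and k: "0 < k"
  shows "expectile M (\<lambda>w. c + k * X w) \<alpha> = c + k * expectile M X \<alpha>"
proof (rule expectile_eqI)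
  let ?e = "expectile M X \<alpha>"
  have "max (c + k * X w - (c + k * ?e)) 0 = k * max (X w - ?e) 0"
    "max (c + k * ?e - (c + k * X w)) 0 = k * max (?e - X w) 0" for w
    using k by (auto simp: max_def algebra_simps)
  then have "expectile_balance M (\<lambda>w. c + k * X w) \<alpha> (c + k * ?e) = k * expectile_balance M X \<alpha> ?e"
    unfolding expectile_balance_def by (simp add: algebra_simps)
  then show "expectile_balance M (\<lambda>w. c + k * X w) \<alpha> (c + k * ?e) = 0"
    using expectile_balance_expectile[OF X \<alpha>] by simp
qed (use X \<alpha> in auto)

lemma expectile_skewness_affine:
  assumes X: "integrable M X" and \<alpha>: "0 < \<alpha>" "\<alpha> < 1" and k: "0 < k"
  shows "expectile_skewness M (\<lambda>w. c + k * X w) \<alpha> = expectile_skewness M X \<alpha>"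
proof -
  let ?a = "expectile M X \<alpha>" and ?b = "expectile M X (1 - \<alpha>)" and ?\<mu> = "\<integral>w. X w \<partial>M"
  have "c + k * ?b + (c + k * ?a) - 2 * (c + k * ?\<mu>) = k * (?b + ?a - 2 * ?\<mu>)"
    "c + k * ?b - (c + k * ?a) = k * (?b - ?a)" by (simp_all add: algebra_simps)
  moreover have "(\<integral>w. c + k * X w \<partial>M) = c + k * ?\<mu>" using X by (simp add: prob_space)
  ultimately show ?thesis
    unfolding expectile_skewness_def using \<alpha> k by (simp add: expectile_affine[OF X])
qed

section \<open>Convex transformations increase expectile skewness\<close>

text \<open>If the transformed variable had the larger mean, the convex function \<open>\<phi>(x) - x\<close> would be
  negative at two points and positive at a point between them.\<close>
lemma mean_convex_transform_le:
  assumes X: "integrable M X" and Z: "integrable M (\<lambda>w. \<phi> (X w))"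
    and S: "AE w in M. X w \<in> S" and cvx: "convex_on S \<phi>" and mono: "mono_on S \<phi>"
    and \<alpha>: "0 < \<alpha>" "\<alpha> < 1 / 2"
    and a: "expectile M (\<lambda>w. \<phi> (X w)) \<alpha> = expectile M X \<alpha>"
    and b: "expectile M (\<lambda>w. \<phi> (X w)) (1 - \<alpha>) = expectile M X (1 - \<alpha>)"
    and ab: "expectile M X \<alpha> \<le> expectile M X (1 - \<alpha>)"
  shows "(\<integral>w. \<phi> (X w) \<partial>M) \<le> (\<integral>w. X w \<partial>M)"
proof (rule ccontr)
  let ?a = "expectile M X \<alpha>" and ?b = "expectile M X (1 - \<alpha>)"
  let ?Z = "\<lambda>w. \<phi> (X w)"
  assume "\<not> ?thesis"
  then have less: "(\<integral>w. X w \<partial>M) < (\<integral>w. ?Z w \<partial>M)" by simp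
  note iX = integrable_max_diff[OF X] and iZ = integrable_max_diff[OF Z]
  have lower: "(\<integral>w. max (?a - X w) 0 \<partial>M) < (\<integral>w. max (?a - ?Z w) 0 \<partial>M)"
  proof -
    have "\<alpha> * ((\<integral>w. X w \<partial>M) - ?a) < \<alpha> * ((\<integral>w. ?Z w \<partial>M) - ?a)" using less \<alpha> by simp
    then show ?thesis
      unfolding expectile_tails(1)[OF X \<alpha>, symmetric] expectile_tails(1)[OF Z \<alpha>, unfolded a, symmetric]
      using \<alpha> by simp
  qed
  have upper: "(\<integral>w. max (?Z w - ?b) 0 \<partial>M) < (\<integral>w. max (X w - ?b) 0 \<partial>M)"
  proof -
    have "\<alpha> * (?b - (\<integral>w. ?Z w \<partial>M)) < \<alpha> * (?b - (\<integral>w. X w \<partial>M))" using less \<alpha> by simp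
    then show ?thesis
      unfolding expectile_tails(2)[OF X \<alpha>, symmetric] expectile_tails(2)[OF Z \<alpha>, unfolded b, symmetric]
      using \<alpha> by simp
  qed
  have clamp: "(\<integral>w. max ?a (min ?b (U w)) \<partial>M)
      = (\<integral>w. U w \<partial>M) - (\<integral>w. max (U w - ?b) 0 \<partial>M) + (\<integral>w. max (?a - U w) 0 \<partial>M)"
    if U: "integrable M U" for U
  proof -
    have "(\<integral>w. max ?a (min ?b (U w)) \<partial>M) = (\<integral>w. U w - max (U w - ?b) 0 + max (?a - U w) 0 \<partial>M)"
      using ab by (intro Bochner_Integration.integral_cong) auto
    then show ?thesis using U integrable_max_diff[OF U] by simp
  qed
  have middle: "(\<integral>w. max ?a (min ?b (X w)) \<partial>M) < (\<integral>w. max ?a (min ?b (?Z w)) \<partial>M)"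
    using less lower upper unfolding clamp[OF X] clamp[OF Z] by linarith
  obtain l where l: "X l \<in> S" "max (?a - X l) 0 < max (?a - ?Z l) 0"
    using integral_less_imp_ex[OF iX(2) iZ(2) S lower] by blast
  obtain r where r: "X r \<in> S" "max (?Z r - ?b) 0 < max (X r - ?b) 0"
    using integral_less_imp_ex[OF iZ(1) iX(1) S upper] by blast
  obtain m where m: "X m \<in> S" "max ?a (min ?b (X m)) < max ?a (min ?b (?Z m))"
    by (rule integral_less_imp_ex[OF _ _ S middle])
      (use X Z in \<open>auto intro!: integrable_max integrable_min\<close>)
  have l': "?Z l < ?a" "?Z l < X l" using l by auto
  have r': "?b < X r" "?Z r < X r" using r by auto
  have m': "X m < ?Z m" "?a < ?Z m" "X m < ?b" using m ab by (auto simp: max_def min_def split: if_splits)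
  have lm: "X l < X m"
    using mono_onD[OF mono m(1) l(1)] l' m' by force
  have mr: "X m < X r" using m' r' by simp
  define v where "v = (X m - X l) / (X r - X l)"
  have v: "0 < v" "v < 1" using lm mr by (auto simp: v_def)
  have "v * (X r - X l) = X m - X l" using lm mr by (simp add: v_def)
  then have comb: "X m = (1 - v) * X l + v * X r" by (simp add: algebra_simps)
  have "?Z m \<le> (1 - v) * ?Z l + v * ?Z r"
    using convex_onD[OF cvx, of v "X l" "X r"] v l r by (simp add: comb)
  also have "\<dots> \<le> (1 - v) * X l + v * X r"
    using v l' r' by (intro add_mono mult_left_mono) auto
  finally show False using m' comb by simp
qed

text \<open>An increasing affine map after \<open>\<phi>\<close> preserves convexity, monotonicity and skewness, and its two
  parameters suffice to make both expectiles agree with those of \<open>X\<close>.\<close>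
lemma expectile_skewness_convex_transform:
  assumes X: "integrable M X" and Z: "integrable M (\<lambda>w. \<phi> (X w))"
    and nX: "non_degenerate M X" and nZ: "non_degenerate M (\<lambda>w. \<phi> (X w))"
    and S: "AE w in M. X w \<in> S" and cvx: "convex_on S \<phi>" and mono: "mono_on S \<phi>"
    and \<alpha>: "0 < \<alpha>" "\<alpha> < 1 / 2"
  shows "expectile_skewness M X \<alpha> \<le> expectile_skewness M (\<lambda>w. \<phi> (X w)) \<alpha>"
proof -
  let ?a = "expectile M X \<alpha>" and ?b = "expectile M X (1 - \<alpha>)"
  let ?a' = "expectile M (\<lambda>w. \<phi> (X w)) \<alpha>" and ?b' = "expectile M (\<lambda>w. \<phi> (X w)) (1 - \<alpha>)"
  have ab: "?a < ?b" using expectile_mean_less[OF X nX \<alpha>] by simp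
  have ab': "?a' < ?b'" using expectile_mean_less[OF Z nZ \<alpha>] by simp
  define k where "k = (?b - ?a) / (?b' - ?a')"
  define c where "c = ?a - k * ?a'"
  have k: "0 < k" using ab ab' by (simp add: k_def)
  have ea: "c + k * ?a' = ?a" by (simp add: c_def)
  have "k * (?b' - ?a') = ?b - ?a" using ab' by (simp add: k_def)
  then have eb: "c + k * ?b' = ?b" by (simp add: c_def algebra_simps)
  let ?\<psi> = "\<lambda>x. c + k * \<phi> x"
  have \<alpha>1: "\<alpha> < 1" "0 < 1 - \<alpha>" "1 - \<alpha> < 1" using \<alpha> by auto
  note e = expectile_affine[OF Z \<alpha>(1) \<alpha>1(1) k, of c, unfolded ea]
    expectile_affine[OF Z \<alpha>1(2,3) k, of c, unfolded eb]
  have "(\<integral>w. ?\<psi> (X w) \<partial>M) \<le> (\<integral>w. X w \<partial>M)"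
  proof (rule mean_convex_transform_le[OF X _ S _ _ \<alpha> e])
    show "integrable M (\<lambda>w. ?\<psi> (X w))" using Z by simp
    show "convex_on S ?\<psi>"
      using k cvx convex_on_imp_convex[OF cvx]
      by (intro convex_on_add convex_on_cmul) (simp_all add: convex_on_const)
    show "mono_on S ?\<psi>" using k mono by (auto simp: mono_on_def)
  qed (use ab in simp)
  then have "expectile_skewness M X \<alpha> \<le> expectile_skewness M (\<lambda>w. ?\<psi> (X w)) \<alpha>"
    unfolding expectile_skewness_def e using ab \<alpha>
    by (intro mult_left_mono divide_right_mono) auto
  then show ?thesis using expectile_skewness_affine[OF Z \<alpha>(1) \<alpha>1(1) k] by simp
qed


section \<open>Support, distribution function and quantile coupling\<close>

text \<open>The complement of the support is a union of open null sets, and countably many of them cover it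
  by the Lindelof property of the line.\<close>
lemma AE_in_rv_support:
  assumes X: "random_variable borel X"
  shows "AE w in M. X w \<in> rv_support M X"
proof -
  let ?D = "distr M borel X"
  interpret D: real_distribution ?D using X by (rule real_distribution_distr)
  define F where "F = {U. open U \<and> measure ?D U = 0}"
  obtain F' where F': "F' \<subseteq> F" "countable F'" "\<Union>F' = \<Union>F"
    by (rule Lindelof[of F]) (auto simp: F_def)
  have "AE x in ?D. \<forall>U\<in>F'. x \<notin> U"
  proof (rule AE_ball_countable'[OF _ F'(2)])
    fix U assume "U \<in> F'"
    then have U: "open U" "measure ?D U = 0" using F'(1) by (auto simp: F_def)
    then have "U \<in> null_sets ?D"
      by (intro null_setsI) (simp_all add: D.emeasure_eq_measure)
    then show "AE x in ?D. x \<notin> U" by (rule AE_not_in)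
  qed
  then have "AE x in ?D. x \<in> rv_support M X"
  proof (rule AE_mp, intro AE_I2 impI)
    fix x assume "\<forall>U\<in>F'. x \<notin> U"
    then have "x \<notin> \<Union>F" using F'(3) by blast
    then show "x \<in> rv_support M X"
      by (auto simp: F_def rv_support_def zero_less_measure_iff measure_le_0_iff)
  qed
  then show ?thesis by (rule AE_distrD[OF X])
qed

text \<open>An interval has at most two points outside its interior, a least and a greatest element, and
  neither is an atom.\<close>
lemma AE_in_interior_rv_support:
  assumes X: "random_variable borel X" and na: "no_atoms M X"
    and int: "is_interval (rv_support M X)"
  shows "AE w in M. X w \<in> interior (rv_support M X)"
proof -
  let ?S = "rv_support M X" and ?D = "distr M borel X"
  interpret D: real_distribution ?D using X by (rule real_distribution_distr)
  have atom: "AE w in M. X w \<noteq> c" for c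
  proof -
    have "{c} \<in> null_sets ?D"
      using na by (intro null_setsI) (simp_all add: D.emeasure_eq_measure no_atoms_def)
    then have "AE x in ?D. x \<notin> {c}" by (rule AE_not_in)
    then show ?thesis using AE_distrD[OF X, of "\<lambda>x. x \<notin> {c}"] by simp
  qed
  have mid: "y \<in> interior ?S" if "x \<in> ?S" "z \<in> ?S" "x < y" "y < z" for x y z
  proof (rule interiorI[of "{x<..<z}"])
    show "{x<..<z} \<subseteq> ?S"
      using int that(1,2) unfolding is_interval_1 by fastforce
  qed (use that in auto)
  (* If there is no least (or greatest) element, THE denotes some arbitrary point; excluding that
     point as well is harmless, since it is not an atom either. *)
  define l where "l = (THE x. x \<in> ?S \<and> (\<forall>y\<in>?S. x \<le> y))"
  define u where "u = (THE x. x \<in> ?S \<and> (\<forall>y\<in>?S. y \<le> x))"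
  have inner: "x \<in> interior ?S" if "x \<in> ?S" "x \<noteq> l" "x \<noteq> u" for x
  proof -
    have "\<not> (\<forall>y\<in>?S. x \<le> y)"
    proof
      assume "\<forall>y\<in>?S. x \<le> y"
      then have "l = x" unfolding l_def using that(1) by (intro the_equality) (auto intro: antisym)
      then show False using that(2) by simp
    qed
    moreover have "\<not> (\<forall>y\<in>?S. y \<le> x)"
    proof
      assume "\<forall>y\<in>?S. y \<le> x"
      then have "u = x" unfolding u_def using that(1) by (intro the_equality) (auto intro: antisym)
      then show False using that(3) by simp
    qed
    ultimately obtain y z where "y \<in> ?S" "y < x" "z \<in> ?S" "x < z" unfolding not_le[symmetric] by blast
    then show ?thesis by (intro mid)
  qed
  have "AE w in M. X w \<in> ?S \<and> X w \<noteq> l \<and> X w \<noteq> u"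
    using AE_in_rv_support[OF X] atom[of l] atom[of u] by (simp add: AE_conj_iff)
  then show ?thesis by (rule AE_mp) (use inner in \<open>auto intro!: AE_I2\<close>)
qed

lemma rv_cdf_strict_mono:
  assumes X: "random_variable borel X" and int: "is_interval (rv_support M X)"
  shows "strict_mono_on (interior (rv_support M X)) (rv_cdf M X)"
proof (rule strict_mono_onI)
  let ?S = "rv_support M X" and ?D = "distr M borel X"
  interpret D: real_distribution ?D using X by (rule real_distribution_distr)
  fix x y assume "x \<in> interior ?S" "y \<in> interior ?S" and xy: "x < y"
  then have "x \<in> ?S" "y \<in> ?S" using interior_subset by auto
  then have "(x + y) / 2 \<in> ?S"
    by (rule mem_is_interval_1_I[OF int]) (use xy in simp_all)
  then have "0 < measure ?D {x<..<y}"
    using xy unfolding rv_support_def by simp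
  also have "\<dots> \<le> measure ?D {x<..y}" by (intro D.finite_measure_mono) auto
  also have "\<dots> = cdf ?D y - cdf ?D x" using D.cdf_diff_eq[OF xy] by simp
  finally show "rv_cdf M X x < rv_cdf M X y" by (simp add: rv_cdf_def)
qed

lemma rv_cdf_eq_prob:
  assumes X: "random_variable borel X"
  shows "rv_cdf M X x = prob {w \<in> space M. X w \<le> x}"
  using X by (simp add: rv_cdf_def cdf_def measure_distr vimage_def Int_def conj_commute)

text \<open>Continuity and the limits at infinity give every value in the open unit interval at some point
  of the line. That point lies in the interior of the support: otherwise the whole mass would be on
  one side of it and the value would be 0 or 1.\<close>
lemma rv_cdf_bij_betw:
  assumes X: "random_variable borel X" and na: "no_atoms M X"
    and int: "is_interval (rv_support M X)"
  shows "bij_betw (rv_cdf M X) (interior (rv_support M X)) {0<..<1}"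
proof -
  let ?I = "interior (rv_support M X)" and ?F = "rv_cdf M X"
  interpret D: real_distribution "distr M borel X" using X by (rule real_distribution_distr)
  have AE: "AE w in M. X w \<in> ?I" by (rule AE_in_interior_rv_support[OF X na int])
  have mono: "strict_mono_on ?I ?F" by (rule rv_cdf_strict_mono[OF X int])
  have bounds: "0 \<le> ?F x" "?F x \<le> 1" for x
    using D.cdf_nonneg D.cdf_bounded_prob by (auto simp: rv_cdf_def)
  have iI: "is_interval ?I" using int by (simp add: is_interval_convex_1 convex_interior)
  have "?F x \<in> {0<..<1}" if x: "x \<in> ?I" for x
  proof -
    obtain e where e: "e > 0" "cball x e \<subseteq> ?I"
      using x open_contains_cball[of ?I] by auto
    then have "x - e \<in> ?I" "x + e \<in> ?I" by (auto simp: dist_real_def subset_iff)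
    then have "?F (x - e) < ?F x" "?F x < ?F (x + e)"
      using strict_mono_onD[OF mono] x e(1) by auto
    then show ?thesis using bounds[of "x - e"] bounds[of "x + e"] by simp
  qed
  moreover have "u \<in> ?F ` ?I" if u: "0 < u" "u < 1" for u
  proof -
    have "\<forall>\<^sub>F x in at_bot. ?F x < u" "\<forall>\<^sub>F x in at_top. u < ?F x"
      using order_tendstoD(2)[OF D.cdf_lim_at_bot u(1)] order_tendstoD(1)[OF D.cdf_lim_at_top_prob u(2)]
      by (simp_all add: rv_cdf_def)
    then obtain a b where ab: "?F a < u" "u < ?F b"
      by (metis eventually_at_bot_linorder eventually_at_top_linorder order_refl)
    have "a \<le> b"
    proof (rule ccontr)
      assume "\<not> a \<le> b"
      then have "?F b \<le> ?F a" unfolding rv_cdf_def by (intro D.cdf_nondecreasing) simp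
      then show False using ab by simp
    qed
    moreover have "isCont ?F x" for x
      using na D.isCont_cdf by (simp add: rv_cdf_def no_atoms_def)
    ultimately obtain y where y: "?F y = u"
      using IVT[of ?F a u b] ab by auto
    have "y \<in> ?I"
    proof (rule ccontr)
      assume "y \<notin> ?I"
      then consider "\<forall>x\<in>?I. x \<le> y" | "\<forall>x\<in>?I. \<not> x \<le> y"
        using iI unfolding is_interval_1 by (meson nle_le)
      then show False
      proof cases
        case 1
        then have "AE w in M. X w \<le> y" using AE by auto
        then have "?F y = 1" using X by (simp add: rv_cdf_eq_prob prob_Collect_eq_1)
        then show False using y u by simp
      next
        case 2
        then have "AE w in M. \<not> X w \<le> y" using AE by auto
        then have "?F y = 0" using X by (simp add: rv_cdf_eq_prob prob_eq_0_AE)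
        then show False using y u by simp
      qed
    qed
    then show ?thesis using y by auto
  qed
  ultimately have "?F ` ?I = {0<..<1}" by fastforce
  then show ?thesis
    using strict_mono_on_imp_inj_on[OF mono] by (simp add: bij_betw_def)
qed

end

text \<open>Since \<open>F\<^sub>Y (\<phi> x) = F\<^sub>X x\<close>, the event \<open>\<phi>(X) \<le> y\<close> is \<open>X \<le> x\<close> for the point \<open>x\<close> with \<open>F\<^sub>X x = F\<^sub>Y y\<close>, so
  both sides have the same distribution function. The composition with the inverse is meaningful only
  on the interior of the support, a set of full measure; the value 0 elsewhere makes \<open>\<phi>\<close> Borel
  measurable on the whole line.\<close>
lemma quantile_coupling:
  assumes M: "prob_space M" and N: "prob_space N"
    and X: "X \<in> borel_measurable M" and Y: "Y \<in> borel_measurable N"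
    and na: "no_atoms M X" "no_atoms N Y"
    and int: "is_interval (rv_support M X)" "is_interval (rv_support N Y)"
    and \<phi>_def: "\<phi> = (\<lambda>x. if x \<in> interior (rv_support M X) then rv_cdf_inv N Y (rv_cdf M X x) else 0)"
  shows "mono_on (interior (rv_support M X)) \<phi>"
    and "\<phi> \<in> borel_measurable borel"
    and "distr M borel (\<lambda>w. \<phi> (X w)) = distr N borel Y"
proof -
  interpret M: prob_space M by fact
  interpret N: prob_space N by fact
  let ?I = "interior (rv_support M X)" and ?J = "interior (rv_support N Y)"
  let ?F = "rv_cdf M X" and ?H = "rv_cdf N Y"
  have F: "bij_betw ?F ?I {0<..<1}" by (rule M.rv_cdf_bij_betw[OF X na(1) int(1)])
  have H: "bij_betw ?H ?J {0<..<1}" by (rule N.rv_cdf_bij_betw[OF Y na(2) int(2)])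
  have sF: "?F x \<le> ?F y \<longleftrightarrow> x \<le> y" if "x \<in> ?I" "y \<in> ?I" for x y
    using strict_mono_on_less_eq[OF M.rv_cdf_strict_mono[OF X int(1)]] that by simp
  have sH: "?H x \<le> ?H y \<longleftrightarrow> x \<le> y" if "x \<in> ?J" "y \<in> ?J" for x y
    using strict_mono_on_less_eq[OF N.rv_cdf_strict_mono[OF Y int(2)]] that by simp
  have \<phi>: "\<phi> x \<in> ?J" "?H (\<phi> x) = ?F x" if "x \<in> ?I" for x
  proof -
    have "?F x \<in> ?H ` ?J" using F H that by (auto simp: bij_betw_def)
    then show "\<phi> x \<in> ?J" "?H (\<phi> x) = ?F x"
      using H that the_inv_into_into[of ?H ?J "?F x" ?J] f_the_inv_into_f[of ?H ?J "?F x"]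
      by (auto simp: \<phi>_def rv_cdf_inv_def bij_betw_def)
  qed
  show mono: "mono_on ?I \<phi>"
  proof (rule mono_onI)
    fix x y assume xy: "x \<in> ?I" "y \<in> ?I" "x \<le> y"
    then have "?H (\<phi> x) \<le> ?H (\<phi> y)" using sF[OF xy(1,2)] \<phi>(2) by simp
    then show "\<phi> x \<le> \<phi> y" using sH \<phi>(1) xy by simp
  qed
  have "(\<lambda>x. if x \<in> ?I then \<phi> x else 0) \<in> borel_measurable borel"
    using borel_measurable_mono_on_fnc[OF mono]
    by (subst measurable_If_restrict_space_iff) auto
  then show meas: "\<phi> \<in> borel_measurable borel" by (simp add: \<phi>_def if_if_eq_conj cong: if_cong)
  then have Z: "(\<lambda>w. \<phi> (X w)) \<in> borel_measurable M" using X by measurable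
  have AX: "AE w in M. X w \<in> ?I" by (rule M.AE_in_interior_rv_support[OF X na(1) int(1)])
  have AY: "AE w in N. Y w \<in> ?J" by (rule N.AE_in_interior_rv_support[OF Y na(2) int(2)])
  have "rv_cdf M (\<lambda>w. \<phi> (X w)) y = ?H y" for y
  proof -
    have "is_interval ?J" using int(2) by (simp add: is_interval_convex_1 convex_interior)
    then consider "y \<in> ?J" | "\<forall>x\<in>?J. x \<le> y" | "\<forall>x\<in>?J. \<not> x \<le> y"
      unfolding is_interval_1 by (meson nle_le)
    then show ?thesis
    proof cases
      case 1
      then have "?H y \<in> ?F ` ?I" using F H by (auto simp: bij_betw_def)
      then obtain x where x: "x \<in> ?I" "?F x = ?H y" by auto
      have "\<phi> z \<le> y \<longleftrightarrow> z \<le> x" if "z \<in> ?I" for z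
        using sF[OF that x(1)] sH[OF \<phi>(1)[OF that] 1] \<phi>(2)[OF that] x(2) by simp
      then have "AE w in M. \<phi> (X w) \<le> y \<longleftrightarrow> X w \<le> x" using AX by auto
      then have "rv_cdf M (\<lambda>w. \<phi> (X w)) y = ?F x"
        unfolding M.rv_cdf_eq_prob[OF Z] M.rv_cdf_eq_prob[OF X] using X Z
        by (intro M.prob_eq_AE) simp_all
      then show ?thesis using x by simp
    next
      case 2
      then have "AE w in M. \<phi> (X w) \<le> y" "AE w in N. Y w \<le> y" using AX AY \<phi>(1) by auto
      then have "rv_cdf M (\<lambda>w. \<phi> (X w)) y = 1" "?H y = 1"
        unfolding M.rv_cdf_eq_prob[OF Z] N.rv_cdf_eq_prob[OF Y] using Y Z
        by (simp_all add: M.prob_Collect_eq_1 N.prob_Collect_eq_1)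
      then show ?thesis by simp
    next
      case 3
      then have "AE w in M. \<not> \<phi> (X w) \<le> y" "AE w in N. \<not> Y w \<le> y" using AX AY \<phi>(1) by auto
      then have "rv_cdf M (\<lambda>w. \<phi> (X w)) y = 0" "?H y = 0"
        unfolding M.rv_cdf_eq_prob[OF Z] N.rv_cdf_eq_prob[OF Y]
        by (simp_all add: M.prob_eq_0_AE N.prob_eq_0_AE)
      then show ?thesis by simp
    qed
  qed
  then show "distr M borel (\<lambda>w. \<phi> (X w)) = distr N borel Y"
    using Y Z by (intro cdf_unique) (auto simp: rv_cdf_def)
qed

lemma expectile_skewness_distr:
  assumes X: "X \<in> borel_measurable M"
  shows "expectile_skewness (distr M borel X) (\<lambda>x. x) \<alpha> = expectile_skewness M X \<alpha>"
proof -
  have [measurable]: "expectile_loss \<beta> \<in> borel_measurable borel" for \<beta>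
    unfolding expectile_loss_def by measurable
  have "expectile (distr M borel X) (\<lambda>x. x) \<beta> = expectile M X \<beta>" for \<beta>
    unfolding expectile_def using X by (simp add: integral_distr)
  then show ?thesis unfolding expectile_skewness_def using X by (simp add: integral_distr)
qed

theorem theorem5:
  fixes M :: "'a measure" and N :: "'b measure"
    and X :: "'a \<Rightarrow> real" and Y :: "'b \<Rightarrow> real" and \<alpha> :: real
  assumes "prob_space M" and "prob_space N"
    and "integrable M X" and "integrable N Y"
    and "non_degenerate M X" and "non_degenerate N Y"
    and "no_atoms M X" and "no_atoms N Y"
    and "is_interval (rv_support M X)" and "is_interval (rv_support N Y)"
    and "convex_transform_le M X N Y"
    and "0 < \<alpha>" and "\<alpha> < 1 / 2"
  shows "expectile_skewness M X \<alpha> \<le> expectile_skewness N Y \<alpha>"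
proof -
  interpret M: prob_space M by fact
  let ?I = "interior (rv_support M X)"
  have X: "X \<in> borel_measurable M" and Y: "Y \<in> borel_measurable N" using assms by auto
  define \<phi> where "\<phi> = (\<lambda>x. if x \<in> ?I then rv_cdf_inv N Y (rv_cdf M X x) else 0)"
  note coupling = quantile_coupling[OF assms(1,2) X Y assms(7-10) \<phi>_def]
  let ?Z = "\<lambda>w. \<phi> (X w)"
  have Z: "?Z \<in> borel_measurable M" using coupling(2) X by measurable
  have "convex_on ?I (rv_cdf_inv N Y \<circ> rv_cdf M X)"
    using assms(11) by (simp add: convex_transform_le_def)
  then have cvx: "convex_on ?I \<phi>"
    unfolding convex_on_def
  proof (elim conjE, intro conjI ballI allI impI)
    fix x y u v :: real
    assume c: "convex ?I" "\<forall>x\<in>?I. \<forall>y\<in>?I. \<forall>u\<ge>0. \<forall>v\<ge>0. u + v = 1 \<longrightarrow>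
        (rv_cdf_inv N Y \<circ> rv_cdf M X) (u *\<^sub>R x + v *\<^sub>R y)
          \<le> u * (rv_cdf_inv N Y \<circ> rv_cdf M X) x + v * (rv_cdf_inv N Y \<circ> rv_cdf M X) y"
      and xy: "x \<in> ?I" "y \<in> ?I" "0 \<le> u" "0 \<le> v" "u + v = 1"
    then show "\<phi> (u *\<^sub>R x + v *\<^sub>R y) \<le> u * \<phi> x + v * \<phi> y"
      using convexD[OF c(1) xy] by (simp add: \<phi>_def)
  qed
  have intZ: "integrable M ?Z"
    using assms(4) integrable_distr_eq[OF Z, of "\<lambda>x. x"] integrable_distr_eq[OF Y, of "\<lambda>x. x"]
    unfolding coupling(3) by simp
  have ndZ: "non_degenerate M ?Z"
  proof -
    have "(AE w in M. ?Z w = c) \<longleftrightarrow> (AE w in N. Y w = c)" for c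
      using AE_distr_iff[OF Z, of "\<lambda>x. x = c"] AE_distr_iff[OF Y, of "\<lambda>x. x = c"]
      unfolding coupling(3) by simp
    then show ?thesis using assms(6) by (simp add: non_degenerate_def)
  qed
  have "expectile_skewness M X \<alpha> \<le> expectile_skewness M ?Z \<alpha>"
    using M.AE_in_interior_rv_support[OF X assms(7,9)]
    by (intro M.expectile_skewness_convex_transform[OF assms(3) intZ assms(5) ndZ _ cvx coupling(1)])
      (use assms in auto)
  also have "\<dots> = expectile_skewness N Y \<alpha>"
    unfolding expectile_skewness_distr[OF Z, symmetric] expectile_skewness_distr[OF Y, symmetric]
      coupling(3) ..
  finally show ?thesis .
qed

end
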